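(* Let $n\geq 3$ be an integer, let $k\geq 2$ be an even integer, and let $G$ be a connected graph of order $n$. (1) If ($n \geq 9$ or $n=3$ or $n=7$) and $e(G)\geq \binom{n-1}{2}+1$, then $G$ is $\mathrm{GFC}_k$ when $n$ is odd and $\mathrm{GBC}_k$ when $n$ is even, unless $G = K_1 \vee (K_{n-2}+K_1)$. (2) If $n\in\{4,6\}$ and $e(G)\geq \frac{3n^2-2n}{8}$, then $G$ is $\mathrm{GBC}_k$ unless $G = K_{\frac{n}{2}} \vee \frac{n}{2}K_1$. (3) If $n=5$ and $e(G)\geq 7$, then $G$ is $\mathrm{GFC}_k$ unless $G = K_2 \vee 3K_1$ or $G = K_1 \vee (K_3+K_1)$. (4) If $n=8$ and $e(G)\geq 22$, then $G$ is $\mathrm{GBC}_k$ unless $G = K_4 \vee 4K_1$ or $G = K_1 \vee (K_6+K_1)$.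
   Context: All graphs are finite, simple and undirected. The order of $G$ is its number of vertices and $e(G)$ is its number of edges. $K_m$ is the complete graph on $m$ vertices, $G_1+G_2$ is the (vertex-disjoint) union, $mK_1$ is the graph consisting of $m$ isolated vertices, and the join $G_1\vee G_2$ is obtained from vertex-disjoint $G_1,G_2$ by adding all edges between $V(G_1)$ and $V(G_2)$. Equality of graphs means isomorphism. Let $i(H)$ denote the number of isolated vertices of a graph $H$. For even $k$ define $$\mathrm{def}_k(G)=\max_{S\subseteq V(G)}\{k\cdot i(G-S)-k|S|\}.$$ A $k$-barrier of $G$ is a subset $S\subseteq V(G)$ attaining this maximum. A graph $G$ of odd order (resp. even order) is generalized factor-critical, written $\mathrm{GFC}_k$ (resp. generalized bicritical, written $\mathrm{GBC}_k$), if $\emptyset$ is its only $k$-barrier. *)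

theory Defs
  imports Complex_Main "Graph_Theory.Graph_Theory"
begin

text \<open>
  A finite simple undirected graph is a digraph satisfying the locale \<open>graph\<close> (finite,
  loop-free, without parallel arcs, symmetric); an undirected edge \<open>uv\<close> is a pair of opposite
  arcs. Equality of graphs in the sense of isomorphism is \<open>digraph_iso\<close>.
\<close>

text \<open>Opposite arcs give the same two-element set, so every undirected edge is counted once.\<close>

definition num_edges :: "('a, 'b) pre_digraph \<Rightarrow> nat" where
  "num_edges G = card ((\<lambda>a. {tail G a, head G a}) ` arcs G)"

definition isolated_verts :: "('a, 'b) pre_digraph \<Rightarrow> 'a set" where
  "isolated_verts H = {v \<in> verts H. \<forall>a \<in> arcs H. tail H a \<noteq> v \<and> head H a \<noteq> v}"

definition delete_verts :: "('a, 'b) pre_digraph \<Rightarrow> 'a set \<Rightarrow> ('a, 'b) pre_digraph" where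
  "delete_verts G S = G \<restriction> (verts G - S)"

text \<open>Deficiency, barriers, GFC and GBC are meant for even \<open>k\<close> only (odd \<open>k\<close> needs another formula).\<close>

definition barrier_value :: "nat \<Rightarrow> ('a, 'b) pre_digraph \<Rightarrow> 'a set \<Rightarrow> int" where
  "barrier_value k G S =
     int k * int (card (isolated_verts (delete_verts G S))) - int k * int (card S)"

definition deficiency :: "nat \<Rightarrow> ('a, 'b) pre_digraph \<Rightarrow> int" where
  "deficiency k G = Max (barrier_value k G ` Pow (verts G))"

definition barriers :: "nat \<Rightarrow> ('a, 'b) pre_digraph \<Rightarrow> 'a set set" where
  "barriers k G = {S. S \<subseteq> verts G \<and> barrier_value k G S = deficiency k G}"

definition GFC :: "nat \<Rightarrow> ('a, 'b) pre_digraph \<Rightarrow> bool" where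
  "GFC k G \<longleftrightarrow> odd (card (verts G)) \<and> barriers k G = {{}}"

definition GBC :: "nat \<Rightarrow> ('a, 'b) pre_digraph \<Rightarrow> bool" where
  "GBC k G \<longleftrightarrow> even (card (verts G)) \<and> barriers k G = {{}}"

definition complete_graph :: "nat \<Rightarrow> nat pair_pre_digraph" where
  "complete_graph m =
     \<lparr> pverts = {..<m}, parcs = {(u, v). u < m \<and> v < m \<and> u \<noteq> v} \<rparr>"

definition edgeless_graph :: "nat \<Rightarrow> nat pair_pre_digraph" where
  "edgeless_graph m = \<lparr> pverts = {..<m}, parcs = {} \<rparr>"

text \<open>Union and join live on the sum type, which makes the two vertex sets disjoint.\<close>

definition graph_union ::
  "'a pair_pre_digraph \<Rightarrow> 'b pair_pre_digraph \<Rightarrow> ('a + 'b) pair_pre_digraph" where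
  "graph_union G H =
     \<lparr> pverts = pverts G <+> pverts H,
       parcs = map_prod Inl Inl ` parcs G \<union> map_prod Inr Inr ` parcs H \<rparr>"

definition graph_join ::
  "'a pair_pre_digraph \<Rightarrow> 'b pair_pre_digraph \<Rightarrow> ('a + 'b) pair_pre_digraph" where
  "graph_join G H =
     \<lparr> pverts = pverts G <+> pverts H,
       parcs = parcs (graph_union G H)
         \<union> (Inl ` pverts G) \<times> (Inr ` pverts H)
         \<union> (Inr ` pverts H) \<times> (Inl ` pverts G) \<rparr>"

lemma complete_digraph_complete_graph: "complete_digraph m (with_proj (complete_graph m))"
  unfolding complete_digraph_pair_def
  by (auto simp: complete_graph_def)

lemma pair_graph_iff:
  "pair_graph G \<longleftrightarrow>
     finite (pverts G) \<and> parcs G \<subseteq> pverts G \<times> pverts G \<and> sym (parcs G) \<and> irrefl (parcs G)"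
proof
  assume "pair_graph G"
  then interpret pair_graph G .
  show "finite (pverts G) \<and> parcs G \<subseteq> pverts G \<times> pverts G \<and> sym (parcs G) \<and> irrefl (parcs G)"
    using pair_finite_verts arc_fst_in_verts arc_snd_in_verts arcs_symmetric no_loops'
    by (fastforce simp: sym_def irrefl_def)
next
  assume *: "finite (pverts G) \<and> parcs G \<subseteq> pverts G \<times> pverts G \<and> sym (parcs G) \<and> irrefl (parcs G)"
  then have "finite (parcs G)" by (meson finite_SigmaI finite_subset)
  with * show "pair_graph G"
    by unfold_locales (auto simp: symmetric_def irrefl_def)
qed

lemma pair_graph_edgeless_graph: "pair_graph (edgeless_graph m)"
  by (simp add: pair_graph_iff edgeless_graph_def sym_def irrefl_def)

lemma pair_graph_graph_union:
  assumes "pair_graph G" "pair_graph H" shows "pair_graph (graph_union G H)"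
  using assms by (fastforce simp: pair_graph_iff graph_union_def sym_def irrefl_def)

lemma pair_graph_graph_join:
  assumes "pair_graph G" "pair_graph H" shows "pair_graph (graph_join G H)"
  using assms pair_graph_graph_union[OF assms]
  by (fastforce simp: pair_graph_iff graph_join_def graph_union_def sym_def irrefl_def)

end

theory Submission
  imports Defs
begin

text \<open>
  If \<open>\<emptyset>\<close> is not the only barrier, some non-empty \<open>S\<close> with \<open>|S| = s\<close> isolates at least \<open>s\<close>
  vertices. Keep exactly \<open>s\<close> of them, \<open>I\<close>: every edge either avoids \<open>I\<close> or joins \<open>S\<close> to \<open>I\<close>, so
  \<open>e(G) \<le> C(n - s, 2) + s\<^sup>2\<close> with \<open>2 s \<le> n\<close>, and equality forces all these pairs to be edges.
  The bound is convex in \<open>s\<close>, hence maximal at \<open>s = 1\<close> or at \<open>s = \<lfloor>n / 2\<rfloor>\<close>; these two values of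
  \<open>s\<close> give the exceptional graphs.
\<close>

section \<open>Recognising the exceptional graphs up to isomorphism\<close>

lemma digraph_isoI:
  assumes "nomulti_digraph G"
    and bij: "bij_betw f (verts G) (pverts H)"
    and ends: "parcs H \<subseteq> pverts H \<times> pverts H"
    and adj: "\<And>u v. u \<in> verts G \<Longrightarrow> v \<in> verts G \<Longrightarrow>
      (u, v) \<in> arcs_ends G \<longleftrightarrow> (f u, f v) \<in> parcs H"
  shows "digraph_iso G (with_proj H)"
proof -
  interpret nomulti_digraph G by fact
  \<comment> \<open>Without parallel arcs an arc is determined by its two ends, and the arcs of
    \<open>with_proj H\<close> are themselves pairs. Hence the vertex map \<open>f\<close> forces
    this arc map, and preserving and reflecting adjacency is enough.\<close>
  let ?g = "\<lambda>a. (f (tail G a), f (head G a))"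
  let ?hom = "\<lparr>iso_verts = f, iso_arcs = ?g, iso_head = snd, iso_tail = fst\<rparr>"
  have inj: "inj_on f (verts G)" and img: "f ` verts G = pverts H"
    using bij by (auto simp: bij_betw_def)
  have "inj_on ?g (arcs G)"
  proof (rule inj_onI)
    fix a b assume ab: "a \<in> arcs G" "b \<in> arcs G" and eq: "?g a = ?g b"
    then have "tail G a = tail G b" "head G a = head G b"
      using inj by (auto dest: inj_onD)
    then show "a = b" using ab by (intro no_multi_arcs) (auto simp: arc_to_ends_def)
  qed
  then have "digraph_isomorphism ?hom"
    using inj wf_digraph by (simp add: digraph_isomorphism_def)
  moreover have "?g ` arcs G = parcs H"
  proof (intro equalityI subsetI)
    fix p assume "p \<in> ?g ` arcs G"
    then obtain a where a: "a \<in> arcs G" and p: "p = ?g a" by auto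
    have "(tail G a, head G a) \<in> arcs_ends G" using a by (auto simp: arcs_ends_conv)
    then show "p \<in> parcs H" using adj[of "tail G a" "head G a"] a p by auto
  next
    fix p assume p: "p \<in> parcs H"
    then have "fst p \<in> f ` verts G" "snd p \<in> f ` verts G" using ends img by auto
    then obtain u v where uv: "u \<in> verts G" "v \<in> verts G" and "fst p = f u" "snd p = f v"
      by auto
    then have puv: "p = (f u, f v)" by (simp add: prod_eq_iff)
    then have "(u, v) \<in> arcs_ends G" using adj[OF uv] p by simp
    then show "p \<in> ?g ` arcs G" using puv by (auto simp: arcs_ends_conv)
  qed
  then have "with_proj H = app_iso ?hom G"
    using img by (simp add: app_iso_def with_proj_def)
  ultimately show ?thesis unfolding digraph_iso_def by blast
qed

lemma parcs_graph_union_iff: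
  "(Inl u, Inl u') \<in> parcs (graph_union G H) \<longleftrightarrow> (u, u') \<in> parcs G"
  "(Inr v, Inr v') \<in> parcs (graph_union G H) \<longleftrightarrow> (v, v') \<in> parcs H"
  "(Inl u, Inr v) \<notin> parcs (graph_union G H)"
  "(Inr v, Inl u) \<notin> parcs (graph_union G H)"
  by (auto simp: graph_union_def)

lemma parcs_graph_join_iff:
  "(Inl u, Inl u') \<in> parcs (graph_join G H) \<longleftrightarrow> (u, u') \<in> parcs G"
  "(Inr v, Inr v') \<in> parcs (graph_join G H) \<longleftrightarrow> (v, v') \<in> parcs H"
  "(Inl u, Inr v) \<in> parcs (graph_join G H) \<longleftrightarrow> u \<in> pverts G \<and> v \<in> pverts H"
  "(Inr v, Inl u) \<in> parcs (graph_join G H) \<longleftrightarrow> u \<in> pverts G \<and> v \<in> pverts H"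
  by (auto simp: graph_join_def graph_union_def)

text \<open>Meant for \<open>S\<close> a barrier and \<open>T\<close> all remaining vertices:
  \<open>S\<close> is a clique joined to everything, \<open>T\<close> is independent. Numbering
  \<open>S\<close> and \<open>T\<close> separately by initial segments of the naturals gives the
  vertex map, and the tags \<open>Inl\<close> and \<open>Inr\<close> keep the two numberings
  apart.\<close>

lemma digraph_iso_join_edgeless:
  assumes "graph G" and ST: "verts G = S \<union> T" "S \<inter> T = {}"
    and adj: "\<And>u v. u \<in> verts G \<Longrightarrow> v \<in> verts G \<Longrightarrow>
      (u, v) \<in> arcs_ends G \<longleftrightarrow> u \<noteq> v \<and> (u \<in> S \<or> v \<in> S)"
  shows "digraph_iso G
    (with_proj (graph_join (complete_graph (card S)) (edgeless_graph (card T))))"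
    (is "digraph_iso G (with_proj ?H)")
proof -
  interpret graph G by fact
  have fin: "finite S" "finite T" using ST finite_verts by (metis finite_Un)+
  obtain g where g: "bij_betw g S {0..<card S}"
    using ex_bij_betw_finite_nat[OF fin(1)] by blast
  obtain h where h: "bij_betw h T {0..<card T}"
    using ex_bij_betw_finite_nat[OF fin(2)] by blast
  let ?f = "\<lambda>u. if u \<in> S then Inl (g u) else Inr (h u)"
  have g_inj: "g u = g v \<longleftrightarrow> u = v" if "u \<in> S" "v \<in> S" for u v
    using g that by (auto simp: bij_betw_def dest: inj_onD)
  have h_inj: "h u = h v \<longleftrightarrow> u = v" if "u \<in> T" "v \<in> T" for u v
    using h that by (auto simp: bij_betw_def dest: inj_onD)
  have g_less: "g u < card S" if "u \<in> S" for u
    using g that by (auto simp: bij_betw_def)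
  have h_less: "h u < card T" if "u \<in> T" for u
    using h that by (auto simp: bij_betw_def)
  have pv: "pverts ?H = Inl ` {..<card S} \<union> Inr ` {..<card T}"
    by (auto simp: graph_join_def complete_graph_def edgeless_graph_def)
  have inj: "inj_on ?f (verts G)"
    using ST g_inj h_inj by (auto simp: inj_on_def)
  have "?f ` verts G = ?f ` S \<union> ?f ` T" unfolding ST by (rule image_Un)
  also have "?f ` S = Inl ` g ` S" by (force simp: image_image)
  also have "?f ` T = Inr ` h ` T" using ST by (force simp: image_image)
  finally have "bij_betw ?f (verts G) (pverts ?H)"
    using inj g h pv by (simp add: bij_betw_def lessThan_atLeast0)
  moreover have "(u, v) \<in> arcs_ends G \<longleftrightarrow> (?f u, ?f v) \<in> parcs ?H"
    if "u \<in> verts G" "v \<in> verts G" for u v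
    using that ST g_less h_less g_inj unfolding adj[OF that]
    by (auto simp: parcs_graph_join_iff complete_graph_def edgeless_graph_def)
  moreover have "parcs ?H \<subseteq> pverts ?H \<times> pverts ?H"
    by (auto simp: graph_join_def graph_union_def complete_graph_def edgeless_graph_def)
  ultimately show ?thesis
    using nomulti_digraph by (intro digraph_isoI) auto
qed

text \<open>Meant for a barrier with a single vertex \<open>a\<close>, which is adjacent to all
  others; \<open>b\<close> is a pendant vertex attached to \<open>a\<close>, and \<open>R\<close> is
  a clique. The tags in \<open>?f\<close> follow the nesting of the union inside the join.\<close>

lemma digraph_iso_join_pendant:
  assumes "graph G" and V: "verts G = insert a (insert b R)"
    and ab: "a \<noteq> b" "a \<notin> R" "b \<notin> R"
    and adj: "\<And>u v. u \<in> verts G \<Longrightarrow> v \<in> verts G \<Longrightarrow>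
      (u, v) \<in> arcs_ends G \<longleftrightarrow> u \<noteq> v \<and> (u = b \<longrightarrow> v = a) \<and> (v = b \<longrightarrow> u = a)"
  shows "digraph_iso G (with_proj (graph_join (complete_graph 1)
    (graph_union (complete_graph (card R)) (complete_graph 1))))"
    (is "digraph_iso G (with_proj ?H)")
proof -
  interpret graph G by fact
  have fin: "finite R" using V finite_verts by simp
  obtain h where h: "bij_betw h R {0..<card R}"
    using ex_bij_betw_finite_nat[OF fin] by blast
  let ?f = "\<lambda>u. if u = a then Inl 0 else if u = b then Inr (Inr 0) else Inr (Inl (h u))"
  have h_inj: "h u = h v \<longleftrightarrow> u = v" if "u \<in> R" "v \<in> R" for u v
    using h that by (auto simp: bij_betw_def dest: inj_onD)
  have h_less: "h u < card R" if "u \<in> R" for u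
    using h that by (auto simp: bij_betw_def)
  have pv: "pverts ?H = {Inl 0, Inr (Inr 0)} \<union> (Inr \<circ> Inl) ` {..<card R}"
    by (auto simp: graph_join_def graph_union_def complete_graph_def)
  have inj: "inj_on ?f (verts G)"
    using V ab h_inj by (auto simp: inj_on_def)
  have fR: "?f ` R = (Inr \<circ> Inl) ` h ` R" using ab by (force simp: image_image)
  have "?f ` verts G = insert (?f a) (insert (?f b) (?f ` R))"
    unfolding V by (simp only: image_insert)
  also have "\<dots> = {Inl 0, Inr (Inr 0)} \<union> (Inr \<circ> Inl) ` h ` R"
    unfolding fR using ab by simp
  finally have "bij_betw ?f (verts G) (pverts ?H)"
    using inj h pv by (simp add: bij_betw_def lessThan_atLeast0)
  moreover have "(u, v) \<in> arcs_ends G \<longleftrightarrow> (?f u, ?f v) \<in> parcs ?H"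
    if "u \<in> verts G" "v \<in> verts G" for u v
    using that V ab h_less h_inj unfolding adj[OF that]
    by (auto simp: parcs_graph_join_iff parcs_graph_union_iff complete_graph_def graph_union_def)
  moreover have "parcs ?H \<subseteq> pverts ?H \<times> pverts ?H"
    by (auto simp: graph_join_def graph_union_def complete_graph_def)
  ultimately show ?thesis
    using nomulti_digraph by (intro digraph_isoI) auto
qed

section \<open>Edge counts and sets that isolate many vertices\<close>

context graph
begin

lemma arcs_endsD:
  assumes "(u, v) \<in> arcs_ends G"
  shows "u \<in> verts G" "v \<in> verts G" "u \<noteq> v" "(v, u) \<in> arcs_ends G"
  using assms adj_in_verts adj_not_same arcs_ends_symmetric[OF sym_arcs] by blast+

lemma num_edges_conv: "num_edges G = card ((\<lambda>(u, v). {u, v}) ` arcs_ends G)"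
  by (simp add: num_edges_def arcs_ends_conv image_image)

text \<open>Both claims come from one inclusion: every edge is a pair avoiding \<open>I\<close> (in
  \<open>?A\<close>) or a pair between \<open>S\<close> and \<open>I\<close> (in \<open>?B\<close>),
  because neighbours of \<open>I\<close> lie in \<open>S\<close>, which is disjoint from
  \<open>I\<close>. Counting gives the bound; when it is attained the inclusion is an equality, so
  every pair that could be an edge is one.\<close>

lemma
  assumes SI: "S \<subseteq> verts G" "I \<subseteq> verts G" "S \<inter> I = {}"
    and nb: "\<And>u v. (u, v) \<in> arcs_ends G \<Longrightarrow> v \<in> I \<Longrightarrow> u \<in> S"
  shows num_edges_le: "num_edges G \<le> (card (verts G) - card I choose 2) + card S * card I"
    and adj_if_num_edges_eq:
      "(card (verts G) - card I choose 2) + card S * card I \<le> num_edges G \<Longrightarrow>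
      u \<in> verts G \<Longrightarrow> v \<in> verts G \<Longrightarrow>
      (u, v) \<in> arcs_ends G \<longleftrightarrow> u \<noteq> v \<and> (u \<in> I \<longrightarrow> v \<in> S) \<and> (v \<in> I \<longrightarrow> u \<in> S)"
proof -
  let ?b = "(card (verts G) - card I choose 2) + card S * card I"
  let ?E = "(\<lambda>(u, v). {u, v}) ` arcs_ends G"
  let ?A = "{e. e \<subseteq> verts G - I \<and> card e = 2}"
  let ?B = "(\<lambda>(u, v). {u, v}) ` (S \<times> I)"
  have fin: "finite S" "finite I" using SI finite_verts finite_subset by blast+
  have "finite {e. e \<subseteq> verts G - I}" using finite_verts by simp
  then have finA: "finite ?A" by (rule rev_finite_subset) auto
  have cardA: "card ?A = (card (verts G) - card I choose 2)"
    using n_subsets[of "verts G - I" 2] SI fin by (simp add: card_Diff_subset)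
  have cardB: "card ?B \<le> card S * card I"
    using card_image_le[of "S \<times> I" "\<lambda>(u, v). {u, v}"] fin by (simp add: card_cartesian_product)
  have finAB: "finite (?A \<union> ?B)" using finA fin by simp
  have cardAB: "card (?A \<union> ?B) \<le> ?b"
    using card_Un_le[of ?A ?B] cardA cardB by linarith
  have sub: "?E \<subseteq> ?A \<union> ?B"
  proof
    fix e assume "e \<in> ?E"
    then obtain u v where e: "e = {u, v}" and uv: "(u, v) \<in> arcs_ends G" by auto
    note D = arcs_endsD[OF uv]
    consider "u \<in> I" | "v \<in> I" | "u \<notin> I" "v \<notin> I" by blast
    then show "e \<in> ?A \<union> ?B"
    proof cases
      case 1
      then have "v \<in> S" using nb[OF D(4)] by simp
      then have "e = (\<lambda>(u, v). {u, v}) (v, u)" "(v, u) \<in> S \<times> I" using 1 e by auto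
      then show ?thesis by blast
    next
      case 2
      then have "e = (\<lambda>(u, v). {u, v}) (u, v)" "(u, v) \<in> S \<times> I" using nb[OF uv] e by auto
      then show ?thesis by blast
    next
      case 3
      then show ?thesis using D e by auto
    qed
  qed
  show "num_edges G \<le> ?b"
    using card_mono[OF finAB sub] cardAB by (simp add: num_edges_conv)
  \<comment> \<open>A subset of a finite set that has at least as many elements is the whole
    set.\<close>
  assume "?b \<le> num_edges G"
  then have "card (?A \<union> ?B) \<le> card ?E" using cardAB by (simp add: num_edges_conv)
  then have EAB: "?E = ?A \<union> ?B" by (rule card_seteq[OF finAB sub])
  assume uv: "u \<in> verts G" "v \<in> verts G"
  show "(u, v) \<in> arcs_ends G \<longleftrightarrow> u \<noteq> v \<and> (u \<in> I \<longrightarrow> v \<in> S) \<and> (v \<in> I \<longrightarrow> u \<in> S)"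
  proof
    assume "(u, v) \<in> arcs_ends G"
    then show "u \<noteq> v \<and> (u \<in> I \<longrightarrow> v \<in> S) \<and> (v \<in> I \<longrightarrow> u \<in> S)"
      using arcs_endsD nb by blast
  next
    assume *: "u \<noteq> v \<and> (u \<in> I \<longrightarrow> v \<in> S) \<and> (v \<in> I \<longrightarrow> u \<in> S)"
    have "{u, v} \<in> ?A \<union> ?B"
    proof (cases "u \<in> I \<or> v \<in> I")
      case True
      then have "(v, u) \<in> S \<times> I \<or> (u, v) \<in> S \<times> I" using * by auto
      moreover have "{u, v} = (\<lambda>(u, v). {u, v}) (u, v)" "{u, v} = (\<lambda>(u, v). {u, v}) (v, u)"
        by auto
      ultimately show ?thesis by blast
    next
      case False
      then show ?thesis using * uv by auto
    qed
    then have "{u, v} \<in> ?E" using EAB by simp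
    \<comment> \<open>The unordered pair forgets the direction of the arc; symmetry of
      \<open>G\<close> supplies the direction asked for.\<close>
    then obtain x y where "{u, v} = {x, y}" "(x, y) \<in> arcs_ends G" by auto
    then show "(u, v) \<in> arcs_ends G" using arcs_endsD(4) by (auto simp: doubleton_eq_iff)
  qed
qed

text \<open>An arc with both ends outside \<open>S\<close> survives the deletion, so an isolated
  vertex that is left can only have had neighbours in \<open>S\<close>.\<close>

lemma isolated_delete_vertsD:
  assumes "S \<subseteq> verts G" "v \<in> isolated_verts (delete_verts G S)"
  shows "v \<in> verts G - S" "\<And>u. (u, v) \<in> arcs_ends G \<Longrightarrow> u \<in> S"
proof -
  show v: "v \<in> verts G - S"
    using assms by (auto simp: isolated_verts_def delete_verts_def)
  fix u assume uv: "(u, v) \<in> arcs_ends G"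
  then obtain a where a: "a \<in> arcs G" "tail G a = u" "head G a = v"
    by (auto simp: arcs_ends_conv)
  show "u \<in> S"
  proof (rule ccontr)
    assume "u \<notin> S"
    then have "a \<in> arcs (delete_verts G S)"
      using a v arcs_endsD[OF uv] by (auto simp: delete_verts_def)
    then show False using a assms(2) by (auto simp: isolated_verts_def delete_verts_def)
  qed
qed

text \<open>A walk from another vertex to a supposedly isolated \<open>v\<close> has a last arc, and
  the tail of that arc would have to lie in the empty set.\<close>

lemma isolated_verts_empty_if_connected:
  assumes "Digraph_Component.connected G" "card (verts G) \<ge> 2"
  shows "isolated_verts (delete_verts G {}) = {}"
proof (rule ccontr)
  assume "isolated_verts (delete_verts G {}) \<noteq> {}"
  then obtain v where v: "v \<in> isolated_verts (delete_verts G {})" by blast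
  note D = isolated_delete_vertsD[OF _ v, simplified]
  have "\<not> verts G \<subseteq> {v}" using assms(2) card_mono[of "{v}" "verts G"] by auto
  then obtain u where u: "u \<in> verts G" "u \<noteq> v" by blast
  then have "u \<rightarrow>\<^sup>*\<^bsub>mk_symmetric G\<^esub> v"
    using assms(1) D(1) by (auto simp: connected_def strongly_connected_def)
  \<comment> \<open>Connectedness is defined through the symmetric closure, which leaves
    reachability in a symmetric digraph unchanged.\<close>
  then have "u \<rightarrow>\<^sup>* v" by (simp only: reachable_mk_symmetric_eq[OF sym_arcs])
  then have "(u, v) \<in> (arcs_ends G)\<^sup>*" by (rule reachable_rtranclI)
  then show False
  proof (cases rule: rtranclE)
    case base
    then show False using u by simp
  next
    case (step w)
    show False by (rule D(2)[OF step(2)])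
  qed
qed

text \<open>The empty set has value 0 and all other sets have negative value, whatever the positive
  factor \<open>k\<close>. Read contrapositively, a further barrier yields a non-empty
  \<open>S\<close> that isolates at least \<open>card S\<close> vertices.\<close>

lemma barriers_eq_singleton_empty:
  assumes "isolated_verts (delete_verts G {}) = {}" "k > 0"
    and less: "\<And>S. S \<subseteq> verts G \<Longrightarrow> S \<noteq> {} \<Longrightarrow>
      card (isolated_verts (delete_verts G S)) < card S"
  shows "barriers k G = {{}}"
proof -
  have zero: "barrier_value k G {} = 0" using assms(1) by (simp add: barrier_value_def)
  have neg: "barrier_value k G S < 0" if "S \<subseteq> verts G" "S \<noteq> {}" for S
    using less[OF that] \<open>k > 0\<close> by (simp add: barrier_value_def)
  have def0: "deficiency k G = 0"
    unfolding deficiency_def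
  proof (rule Max_eqI)
    show "finite (barrier_value k G ` Pow (verts G))" by simp
    show "0 \<in> barrier_value k G ` Pow (verts G)" using zero by force
    show "y \<le> 0" if "y \<in> barrier_value k G ` Pow (verts G)" for y
    proof -
      from that obtain S where "S \<subseteq> verts G" "y = barrier_value k G S" by auto
      then show ?thesis using zero neg[of S] by (cases "S = {}") auto
    qed
  qed
  have "S \<subseteq> verts G \<and> barrier_value k G S = 0 \<longleftrightarrow> S = {}" for S
    using zero neg[of S] by (cases "S = {}") auto
  then show ?thesis unfolding barriers_def def0 by simp
qed

text \<open>Equality in the bound determines every adjacency. The two conditional conclusions cover
  the values of \<open>s\<close> for which the remainder \<open>?R\<close>, a clique joined to
  \<open>S\<close>, leads to an exceptional graph: \<open>s = 1\<close>, where \<open>I\<close> is a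
  pendant vertex, and \<open>s\<close> equal to the floor of n/2, where \<open>?R\<close> has at
  most one vertex.\<close>

lemma extremal_structure:
  assumes "Digraph_Component.connected G" "card (verts G) = n" "n \<ge> 2" "k > 0"
    and "barriers k G \<noteq> {{}}"
  obtains s where "1 \<le> s" "2 * s \<le> n" "num_edges G \<le> (n - s choose 2) + s * s"
    and "num_edges G = (n - s choose 2) + s * s \<Longrightarrow> s = 1 \<Longrightarrow>
      digraph_iso G (with_proj (graph_join (complete_graph 1)
        (graph_union (complete_graph (n - 2)) (complete_graph 1))))"
    and "num_edges G = (n - s choose 2) + s * s \<Longrightarrow> n \<le> 2 * s + 1 \<Longrightarrow>
      digraph_iso G (with_proj (graph_join (complete_graph s) (edgeless_graph (n - s))))"
proof -
  have G: "graph G" by unfold_locales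
  obtain S where S: "S \<subseteq> verts G" "S \<noteq> {}"
    and "card S \<le> card (isolated_verts (delete_verts G S))"
    using assms barriers_eq_singleton_empty isolated_verts_empty_if_connected
    by (metis not_less)
  then obtain I where I: "I \<subseteq> isolated_verts (delete_verts G S)" "card I = card S" "finite I"
    by (meson obtain_subset_with_card_n)
  let ?s = "card S"
  have IV: "I \<subseteq> verts G" and SI: "S \<inter> I = {}"
    and nb: "\<And>u v. (u, v) \<in> arcs_ends G \<Longrightarrow> v \<in> I \<Longrightarrow> u \<in> S"
    using isolated_delete_vertsD[OF S(1)] I(1) by blast+
  have finS: "finite S" using S finite_verts finite_subset by blast
  have s1: "1 \<le> ?s" using S finS by (simp add: Suc_le_eq card_gt_0_iff)
  have "card (S \<union> I) \<le> n" using card_mono[OF finite_verts, of "S \<union> I"] S IV assms(2) by simp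
  then have s2: "2 * ?s \<le> n" using card_Un_disjoint[OF finS I(3) SI] I(2) by simp
  let ?R = "verts G - (S \<union> I)"
  have cR: "card ?R = n - 2 * ?s"
    using card_Diff_subset[of "S \<union> I" "verts G"] card_Un_disjoint[OF finS I(3) SI] I S IV finS assms(2)
    by simp
  have le: "num_edges G \<le> (n - ?s choose 2) + ?s * ?s"
    using num_edges_le[OF S(1) IV SI nb] I(2) assms(2) by simp
  have adj: "(u, v) \<in> arcs_ends G \<longleftrightarrow> u \<noteq> v \<and> (u \<in> I \<longrightarrow> v \<in> S) \<and> (v \<in> I \<longrightarrow> u \<in> S)"
    if "num_edges G = (n - ?s choose 2) + ?s * ?s" "u \<in> verts G" "v \<in> verts G" for u v
    by (rule adj_if_num_edges_eq[OF S(1) IV SI]) (use nb that I(2) assms(2) in auto)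
  show thesis
  proof (rule that[OF s1 s2 le])
    assume eq: "num_edges G = (n - ?s choose 2) + ?s * ?s" and "?s = 1"
    then obtain a b where ab: "S = {a}" "I = {b}" using I(2) by (metis card_1_singletonE)
    have "digraph_iso G (with_proj (graph_join (complete_graph 1)
        (graph_union (complete_graph (card ?R)) (complete_graph 1))))"
    proof (rule digraph_iso_join_pendant[OF G, of a b])
      show "verts G = insert a (insert b ?R)" using ab S IV by auto
      show "(u, v) \<in> arcs_ends G \<longleftrightarrow> u \<noteq> v \<and> (u = b \<longrightarrow> v = a) \<and> (v = b \<longrightarrow> u = a)"
        if "u \<in> verts G" "v \<in> verts G" for u v
        using adj[OF eq that] ab by auto
    qed (use ab SI in auto)
    then show "digraph_iso G (with_proj (graph_join (complete_graph 1)
        (graph_union (complete_graph (n - 2)) (complete_graph 1))))"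
      using cR \<open>?s = 1\<close> by simp
  next
    assume eq: "num_edges G = (n - ?s choose 2) + ?s * ?s" and "n \<le> 2 * ?s + 1"
    \<comment> \<open>With at most one vertex, \<open>?R\<close> contains no edge, and it has none
      to \<open>I\<close> either. So \<open>?R\<close> can be merged with \<open>I\<close> into one
      independent set of size \<open>n - s\<close>, which is \<open>s\<close> or
      \<open>s + 1\<close>.\<close>
    then have R1: "x = y" if "x \<in> ?R" "y \<in> ?R" for x y
      using cR that card_le_Suc0_iff_eq[of ?R] by auto
    have "digraph_iso G
      (with_proj (graph_join (complete_graph ?s) (edgeless_graph (card (verts G - S)))))"
    proof (rule digraph_iso_join_edgeless[OF G])
      show "(u, v) \<in> arcs_ends G \<longleftrightarrow> u \<noteq> v \<and> (u \<in> S \<or> v \<in> S)"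
        if "u \<in> verts G" "v \<in> verts G" for u v
        using adj[OF eq that] R1[of u v] that SI by auto
    qed (use S in auto)
    then show "digraph_iso G (with_proj (graph_join (complete_graph ?s) (edgeless_graph (n - ?s))))"
      using card_Diff_subset[OF finS S(1)] assms(2) by simp
  qed
qed

end

section \<open>Comparison of the edge bound with its value at \<open>s = 1\<close>\<close>

lemma extremal_bound_less:
  fixes n s :: nat
  assumes "n \<ge> 9 \<or> n = 7" "2 \<le> s" "2 * s \<le> n"
  shows "(n - s choose 2) + s * s < (n - 1 choose 2) + 1"
proof -
  have c2: "2 * int (m choose 2) = int m * (int m - 1)" for m
    by (induction m) (auto simp: numeral_2_eq_2 algebra_simps)
  \<comment> \<open>For \<open>s\<close> at least 5 this follows from 3s + 4 < 4s \<le> 2n; smaller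
    \<open>s\<close> use the restriction on \<open>n\<close>. At s = 2, n = 5 and at s = 4, n = 8
    equality would hold, and at s = 2, n = 4 and at s = 3, n = 6 the inequality is reversed. These
    are the orders treated separately.\<close>
  have "3 * s + 4 < 2 * n"
  proof -
    consider "s = 2" | "s = 3" | "s = 4" | "s \<ge> 5" using assms(2) by linarith
    then show ?thesis by cases (use assms in auto)
  qed
  then have "2 * int n - 3 * int s - 4 > 0" by linarith
  then have "(int s - 1) * (2 * int n - 3 * int s - 4) > 0" using assms by simp
  \<comment> \<open>Doubling removes the division in the binomial coefficients. The difference
    vanishes at s = 1, whence the factor s - 1; the cofactor is the quantity just shown to be
    positive.\<close>
  moreover have "2 * int ((n - 1 choose 2) + 1) - 2 * int ((n - s choose 2) + s * s)
      = (int s - 1) * (2 * int n - 3 * int s - 4)"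
  proof -
    \<comment> \<open>The bounds on \<open>s\<close> and \<open>n\<close> ensure that neither
      natural subtraction is truncated.\<close>
    have "int (n - 1) = int n - 1" "int (n - s) = int n - int s" using assms by auto
    then have "2 * int (n - 1 choose 2) = (int n - 1) * (int n - 2)"
      "2 * int (n - s choose 2) = (int n - int s) * (int n - int s - 1)"
      using c2[of "n - 1"] c2[of "n - s"] by simp_all
    then show ?thesis unfolding of_nat_add distrib_left by (simp add: algebra_simps)
  qed
  moreover have "a < b" if "0 < 2 * int b - 2 * int a" for a b :: nat
    using that by linarith
  ultimately show ?thesis by metis
qed

section \<open>The four ranges of the order\<close>

theorem theorem6p1:
  fixes G :: "('a, 'b) pre_digraph" and n k :: nat
  assumes "n \<ge> 3"
    and "k \<ge> 2" and "even k"
    and "graph G" and "Digraph_Component.connected G" and "card (verts G) = n"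
  shows
    "((n \<ge> 9 \<or> n = 3 \<or> n = 7) \<and> num_edges G \<ge> ((n - 1) choose 2) + 1
       \<and> \<not> digraph_iso G (with_proj (graph_join (complete_graph 1)
              (graph_union (complete_graph (n - 2)) (complete_graph 1))))
      \<longrightarrow> (odd n \<longrightarrow> GFC k G) \<and> (even n \<longrightarrow> GBC k G))
     \<and>
     (n \<in> {4, 6} \<and> real (num_edges G) \<ge> (3 * (real n)\<^sup>2 - 2 * real n) / 8
       \<and> \<not> digraph_iso G (with_proj (graph_join (complete_graph (n div 2)) (edgeless_graph (n div 2))))
      \<longrightarrow> GBC k G)
     \<and>
     (n = 5 \<and> num_edges G \<ge> 7
       \<and> \<not> digraph_iso G (with_proj (graph_join (complete_graph 2) (edgeless_graph 3)))
       \<and> \<not> digraph_iso G (with_proj (graph_join (complete_graph 1)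
              (graph_union (complete_graph 3) (complete_graph 1))))
      \<longrightarrow> GFC k G)
     \<and>
     (n = 8 \<and> num_edges G \<ge> 22
       \<and> \<not> digraph_iso G (with_proj (graph_join (complete_graph 4) (edgeless_graph 4)))
       \<and> \<not> digraph_iso G (with_proj (graph_join (complete_graph 1)
              (graph_union (complete_graph 6) (complete_graph 1))))
      \<longrightarrow> GBC k G)"
proof -
  interpret graph G by fact
  show ?thesis
  proof (cases "barriers k G = {{}}")
    case True
    then have "odd n \<Longrightarrow> GFC k G" "even n \<Longrightarrow> GBC k G"
      using \<open>card (verts G) = n\<close> by (simp_all add: GFC_def GBC_def)
    moreover have "odd n" if "n = 5" using that by simp
    moreover have "even n" if "n \<in> {4, 6}" using that by auto
    moreover have "even n" if "n = 8" using that by simp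
    ultimately show ?thesis by (intro conjI impI; elim conjE) blast+
  next
    \<comment> \<open>There is now a barrier violating the conclusion, so in each range the edge
      hypothesis has to force one of the excluded graphs.\<close>
    case False
    have "n \<ge> 2" "k > 0" using assms by auto
    obtain s where s: "1 \<le> s" "2 * s \<le> n" and le: "num_edges G \<le> (n - s choose 2) + s * s"
      and pendant: "num_edges G = (n - s choose 2) + s * s \<Longrightarrow> s = 1 \<Longrightarrow>
        digraph_iso G (with_proj (graph_join (complete_graph 1)
          (graph_union (complete_graph (n - 2)) (complete_graph 1))))"
      and edgeless: "num_edges G = (n - s choose 2) + s * s \<Longrightarrow> n \<le> 2 * s + 1 \<Longrightarrow>
        digraph_iso G (with_proj (graph_join (complete_graph s) (edgeless_graph (n - s))))"
      using extremal_structure[OF assms(5,6) \<open>n \<ge> 2\<close> \<open>k > 0\<close> False] by blast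
    have "digraph_iso G (with_proj (graph_join (complete_graph 1)
          (graph_union (complete_graph (n - 2)) (complete_graph 1))))"
      if "n \<ge> 9 \<or> n = 3 \<or> n = 7" "num_edges G \<ge> ((n - 1) choose 2) + 1"
    proof (rule pendant)
      \<comment> \<open>For n = 3 this is immediate from 2s \<le> 3; otherwise any larger
        \<open>s\<close> would put the number of edges strictly below the threshold.\<close>
      show "s = 1"
        using extremal_bound_less[of n s] that s le by (cases "n = 3"; cases "s = 1") auto
      then show "num_edges G = (n - s choose 2) + s * s" using that le by simp
    qed
    moreover have "digraph_iso G
        (with_proj (graph_join (complete_graph (n div 2)) (edgeless_graph (n div 2))))"
      if "n \<in> {4, 6}" "real (num_edges G) \<ge> (3 * (real n)\<^sup>2 - 2 * real n) / 8"
    proof -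
      have "s = 1 \<or> s = 2 \<or> s = 3" using s that by auto
      \<comment> \<open>The threshold is the bound at s = n/2. For n = 4 the bounds for s = 1, 2 are
        4, 5 and the threshold is 5; for n = 6 the bounds for s = 1, 2, 3 are 11, 10, 12 and the
        threshold is 12.\<close>
      then have "n = 2 * s \<and> num_edges G = (n - s choose 2) + s * s"
        using that s le by (auto simp: choose_two)
      then show ?thesis using edgeless by auto
    qed
    moreover have "digraph_iso G (with_proj (graph_join (complete_graph 2) (edgeless_graph 3)))
        \<or> digraph_iso G (with_proj (graph_join (complete_graph 1)
              (graph_union (complete_graph 3) (complete_graph 1))))"
      if "n = 5" "num_edges G \<ge> 7"
    proof -
      \<comment> \<open>Both values of \<open>s\<close> give the bound 7, so both exceptional graphs
        occur.\<close>
      have "s = 1 \<or> s = 2" using s that by auto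
      then show ?thesis using pendant edgeless that le by (auto simp: choose_two)
    qed
    moreover have "digraph_iso G (with_proj (graph_join (complete_graph 4) (edgeless_graph 4)))
        \<or> digraph_iso G (with_proj (graph_join (complete_graph 1)
              (graph_union (complete_graph 6) (complete_graph 1))))"
      if "n = 8" "num_edges G \<ge> 22"
    proof -
      \<comment> \<open>The bounds are 22, 19, 19, 22, so the two middle values are excluded and
        each end gives one exceptional graph.\<close>
      have "s = 1 \<or> s = 2 \<or> s = 3 \<or> s = 4" using s that by auto
      then show ?thesis using pendant edgeless that le by (auto simp: choose_two)
    qed
    ultimately show ?thesis by blast
  qed
qed

end
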